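(* Let $P,Q,b_0\in\mathbb C$ and let $x,y,z:\mathbb Z^2\to\mathbb C$ satisfy the B2 lattice system at every lattice point, with $x_{1,0}\neq x_{0,1}$ at every lattice point: $$y_{1,0}+z_{0,0}=x_{0,0}x_{1,0},\qquad y_{0,1}+z_{0,0}=x_{0,0}x_{0,1},$$ $$y_{0,0}+z_{1,1}=x_{0,0}x_{1,1}+b_0(x_{1,1}-x_{0,0})+\frac{P-Q}{x_{1,0}-x_{0,1}} .$$ Then $x$ satisfies, at every lattice point, the one-component equation on the $3\times3$ stencil $$(P-Q)\left(\frac1{x_{2,0}-x_{1,1}}-\frac1{x_{1,1}-x_{0,2}}\right)+b_0(x_{0,1}-x_{1,0}+x_{2,1}-x_{1,2})-(x_{2,2}-x_{0,1})(x_{2,1}-x_{1,2})-(x_{0,0}-x_{2,1})(x_{1,0}-x_{0,1})=0 .$$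
   Context: For a function $u$ on $\mathbb Z^2$ and a generic base point $(n,m)$, $u_{\nu,\mu}$ denotes $u(n+\nu,m+\mu)$; an equation "holds at every lattice point" if it holds for every $(n,m)\in\mathbb Z^2$. The three-component B2 system is a lattice version of the Boussinesq equation (an additional removable constant has been set to zero). *)

theory Defs
  imports Complex_Main
begin

definition B2_lattice_system ::
  "complex \<Rightarrow> complex \<Rightarrow> complex \<Rightarrow> (int \<Rightarrow> int \<Rightarrow> complex) \<Rightarrow> (int \<Rightarrow> int \<Rightarrow> complex) \<Rightarrow>
    (int \<Rightarrow> int \<Rightarrow> complex) \<Rightarrow> bool"
where
  "B2_lattice_system P Q b\<^sub>0 x y z \<longleftrightarrow>
    (\<forall>n m.
      y (n + 1) m + z n m = x n m * x (n + 1) m \<and>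
      y n (m + 1) + z n m = x n m * x n (m + 1) \<and>
      y n m + z (n + 1) (m + 1) =
        x n m * x (n + 1) (m + 1) + b\<^sub>0 * (x (n + 1) (m + 1) - x n m)
        + (P - Q) / (x (n + 1) m - x n (m + 1)))"

end

(* Subtracting the third equation at (n, m+1) from the one at (n+1, m) eliminates y and z: the
   first two equations at (n, m) give the difference of the y-terms, and evaluated where their
   y-terms meet at (n+2, m+2) they give the difference of the z-terms. *)
theory Submission
  imports Defs
begin

theorem mainTheorem1:
  fixes P Q b\<^sub>0 :: complex
    and x y z :: "int \<Rightarrow> int \<Rightarrow> complex"
  assumes "B2_lattice_system P Q b\<^sub>0 x y z"
    and "\<forall>n m. x (n + 1) m \<noteq> x n (m + 1)"
  shows "\<forall>n m.
    (P - Q) * (1 / (x (n + 2) m - x (n + 1) (m + 1)) - 1 / (x (n + 1) (m + 1) - x n (m + 2)))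
    + b\<^sub>0 * (x n (m + 1) - x (n + 1) m + x (n + 2) (m + 1) - x (n + 1) (m + 2))
    - (x (n + 2) (m + 2) - x n (m + 1)) * (x (n + 2) (m + 1) - x (n + 1) (m + 2))
    - (x n m - x (n + 2) (m + 1)) * (x (n + 1) m - x n (m + 1)) = 0"
proof (intro allI)
  fix n m :: int
  \<comment> \<open>Instances of the system at shifted points carry indices such as
    \<open>n + 1 + 1\<close>; normalising them makes equal lattice values syntactically equal, as
    \<open>algebra\<close> requires.\<close>
  have shift: "n + 1 + 1 = n + 2" "m + 1 + 1 = m + 2"
    by simp_all
  have eq1: "y (i + 1) j + z i j = x i j * x (i + 1) j"
    and eq2: "y i (j + 1) + z i j = x i j * x i (j + 1)"
    and eq3: "y i j + z (i + 1) (j + 1) = x i j * x (i + 1) (j + 1)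
      + b\<^sub>0 * (x (i + 1) (j + 1) - x i j) + (P - Q) / (x (i + 1) j - x i (j + 1))" for i j
    using assms(1) unfolding B2_lattice_system_def by blast+
  have y_diff: "y (n + 1) m - y n (m + 1) = x n m * (x (n + 1) m - x n (m + 1))"
    using eq1[of n m] eq2[of n m] by algebra
  have z_diff: "z (n + 2) (m + 1) - z (n + 1) (m + 2)
      = x (n + 2) (m + 2) * (x (n + 2) (m + 1) - x (n + 1) (m + 2))"
    using eq2[of "n + 2" "m + 1", unfolded shift] eq1[of "n + 1" "m + 2", unfolded shift]
    by algebra
  \<comment> \<open>With the two reciprocals as atoms \<open>u\<close> and \<open>v\<close>, the
    remaining elimination is purely polynomial.\<close>
  define u where "u = 1 / (x (n + 2) m - x (n + 1) (m + 1))"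
  define v where "v = 1 / (x (n + 1) (m + 1) - x n (m + 2))"
  have "y (n + 1) m + z (n + 2) (m + 1) = x (n + 1) m * x (n + 2) (m + 1)
      + b\<^sub>0 * (x (n + 2) (m + 1) - x (n + 1) m) + (P - Q) * u"
    using eq3[of "n + 1" m, unfolded shift] by (simp add: u_def)
  moreover have "y n (m + 1) + z (n + 1) (m + 2) = x n (m + 1) * x (n + 1) (m + 2)
      + b\<^sub>0 * (x (n + 1) (m + 2) - x n (m + 1)) + (P - Q) * v"
    using eq3[of n "m + 1", unfolded shift] by (simp add: v_def)
  \<comment> \<open>The difference leaves the products \<open>x (n + 1) m * x (n + 2) (m + 1) - x n
    (m + 1) * x (n + 1) (m + 2)\<close>. Adding and subtracting
    \<open>x n (m + 1) * x (n + 2) (m + 1)\<close> splits them between the two factored terms of the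
    goal.\<close>
  ultimately show "(P - Q) * (1 / (x (n + 2) m - x (n + 1) (m + 1))
        - 1 / (x (n + 1) (m + 1) - x n (m + 2)))
    + b\<^sub>0 * (x n (m + 1) - x (n + 1) m + x (n + 2) (m + 1) - x (n + 1) (m + 2))
    - (x (n + 2) (m + 2) - x n (m + 1)) * (x (n + 2) (m + 1) - x (n + 1) (m + 2))
    - (x n m - x (n + 2) (m + 1)) * (x (n + 1) m - x n (m + 1)) = 0"
    using y_diff z_diff unfolding u_def[symmetric] v_def[symmetric] by algebra
qed

end
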